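(* Let $s\ge0$ be an integer with $s\ne1$, let $h\in\mathbb C\setminus\{0\}$, and let $q\in\mathbb C\setminus\{0\}$ be either $1$ or not a root of unity. Let $n\ge1$ and let $\mathbf r=(r_1,\ldots,r_n)$, $\mathbf s=(s_1,\ldots,s_n)$ be sequences of nonnegative integers. Then for every integer $k\ge0$, $$S^{\mathbf r,\mathbf s}_{s,h,q}[k]=\frac{h^{|\mathbf s|-k}}{[k]_{q,1-s}!}\sum_{j=0}^k(-1)^{k-j}q^{\binom{k-j}2(1-s)}\genfrac{[}{]}{0pt}{}{k}{j}_{q^{1-s}}\Omega^{\mathbf r,\mathbf s}_{s,q}[j],$$ where $$\Omega^{\mathbf r,\mathbf s}_{s,q}[j]=\prod_{t=1}^n\bigl[\,j-(s_1+\cdots+s_{t-1})+(r_1+\cdots+r_{t-1})/(1-s)\,\bigr]^{(\underline{s_t})}_{q,1-s}.$$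
   Context: For an integer $x$, $[x]_q=\frac{q^x-1}{q-1}$ if $q\ne1$ and $[x]_1=x$. For $r\in\mathbb R$ and an integer $j\ge0$, $[r]^{(\underline j)}_{q,1-s}=[r(1-s)]_q[(r-1)(1-s)]_q\cdots[(r-j+1)(1-s)]_q$ (in the statement all the numbers $(r-i)(1-s)$ that occur are integers), and $[n]_{q,1-s}!=[n]^{(\underline n)}_{q,1-s}$. $\genfrac{[}{]}{0pt}{}{k}{j}_p$ is the Gaussian ($p$-binomial) coefficient. $|\cdot|$ denotes the sum of the entries of a finite sequence. The numbers $S^{\mathbf r,\mathbf s}_{s,h,q}[k]$ are the normal ordering coefficients of $H_{\mathbf r,\mathbf s}=V^{r_n}U^{s_n}\cdots V^{r_2}U^{s_2}V^{r_1}U^{s_1}$ where $UV-qVU=hV^s$: in the algebra $\mathbb C\langle U,V\rangle/(UV-qVU-hV^s)$ (in which the monomials $V^iU^j$, $i,j\ge0$, form a basis), $H_{\mathbf r,\mathbf s}=\sum_{k=s_1}^{|\mathbf s|}S^{\mathbf r,\mathbf s}_{s,h,q}[k]\,V^{|\mathbf r|-(|\mathbf s|-k)(1-s)}U^k$, the coefficient being taken as $0$ when the exponent of $V$ is negative, and $S^{\mathbf r,\mathbf s}_{s,h,q}[k]=0$ when $k<s_1$ or $k>|\mathbf s|$. *)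

theory Defs
  imports
    "HOL-Library.Poly_Mapping"
    Complex_Main
    "HOL-Algebra.QuotRing"
begin

section \<open>The algebra generated by \<open>U\<close> and \<open>V\<close> with \<open>UV - qVU = hV\<^sup>s\<close>\<close>

datatype letter = Letter_U | Letter_V

text \<open>The free monoid on two letters. A separate type is used, so that no monoid structure is put
  on the library's lists.\<close>

datatype word = Word (letters: "letter list")

instantiation word :: monoid_add
begin

definition zero_word :: word where
  "0 = Word []"

definition plus_word :: "word \<Rightarrow> word \<Rightarrow> word" where
  "v + w = Word (letters v @ letters w)"

instance
  by standard (simp_all add: zero_word_def plus_word_def)

end

text \<open>The monoid algebra of \<^typ>\<open>word\<close>, that is, the free algebra
  \<open>\<complex>\<langle>U,V\<rangle>\<close>; its multiplication is the convolution product of \<^theory>\<open>HOL-Library.Poly_Mapping\<close>.\<close>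

type_synonym free_UV = "word \<Rightarrow>\<^sub>0 complex"

definition gen_U :: free_UV where
  "gen_U = Poly_Mapping.single (Word [Letter_U]) 1"

definition gen_V :: free_UV where
  "gen_V = Poly_Mapping.single (Word [Letter_V]) 1"

definition scalar :: "complex \<Rightarrow> free_UV" where
  "scalar c = Poly_Mapping.single 0 c"

definition free_UV_ring :: "free_UV ring" where
  "free_UV_ring = \<lparr>carrier = UNIV, mult = (*), one = 1, zero = 0, add = (+)\<rparr>"

text \<open>\<^const>\<open>genideal\<close> generates two-sided ideals, also in noncommutative rings.\<close>

definition UV_ideal :: "nat \<Rightarrow> complex \<Rightarrow> complex \<Rightarrow> free_UV set" where
  "UV_ideal s h q =
     Idl\<^bsub>free_UV_ring\<^esub> {gen_U * gen_V - scalar q * (gen_V * gen_U) - scalar h * gen_V ^ s}"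

definition UV_algebra :: "nat \<Rightarrow> complex \<Rightarrow> complex \<Rightarrow> free_UV set ring" where
  "UV_algebra s h q = free_UV_ring Quot UV_ideal s h q"

definition UV_class :: "nat \<Rightarrow> complex \<Rightarrow> complex \<Rightarrow> free_UV \<Rightarrow> free_UV set" where
  "UV_class s h q x = UV_ideal s h q +>\<^bsub>free_UV_ring\<^esub> x"

lemma ring_free_UV_ring: "ring free_UV_ring"
proof (rule ringI)
  show "abelian_group free_UV_ring"
  proof (rule abelian_groupI)
    fix x assume "x \<in> carrier free_UV_ring"
    show "\<exists>y\<in>carrier free_UV_ring. y \<oplus>\<^bsub>free_UV_ring\<^esub> x = \<zero>\<^bsub>free_UV_ring\<^esub>"
      by (intro bexI[of _ "- x"]) (simp_all add: free_UV_ring_def)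
  qed (simp_all add: free_UV_ring_def ac_simps)
  show "monoid free_UV_ring"
    by (rule monoidI) (simp_all add: free_UV_ring_def mult.assoc)
qed (simp_all add: free_UV_ring_def distrib_left distrib_right)

lemma ideal_UV_ideal: "ideal (UV_ideal s h q) free_UV_ring"
  unfolding UV_ideal_def
  by (rule ring.genideal_ideal[OF ring_free_UV_ring])
     (simp add: free_UV_ring_def)

lemma UV_class_ring_hom: "UV_class s h q \<in> ring_hom free_UV_ring (UV_algebra s h q)"
  using ideal.rcos_ring_hom[OF ideal_UV_ideal, of s h q]
  unfolding UV_class_def UV_algebra_def .


section \<open>Normal ordering coefficients\<close>

text \<open>The word \<open>V\<^bsup>r\<^sub>n\<^esup> U\<^bsup>s\<^sub>n\<^esup> \<cdots> V\<^bsup>r\<^sub>1\<^esup> U\<^bsup>s\<^sub>1\<^esup>\<close>;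
  the lists start with \<open>r\<^sub>1\<close> and \<open>s\<^sub>1\<close>, which belong to the rightmost factor.\<close>

definition H_word :: "nat list \<Rightarrow> nat list \<Rightarrow> free_UV" where
  "H_word rs ss = prod_list (rev (map2 (\<lambda>a b. gen_V ^ a * gen_U ^ b) rs ss))"

definition V_exponent :: "nat \<Rightarrow> nat list \<Rightarrow> nat list \<Rightarrow> nat \<Rightarrow> int" where
  "V_exponent s rs ss k =
     int (sum_list rs) - (int (sum_list ss) - int k) * (1 - int s)"

text \<open>In the sum, \<^const>\<open>nat\<close> truncates negative exponents to 0, but the corresponding
  coefficients are required to vanish.\<close>

definition is_normal_ordering ::
  "nat \<Rightarrow> complex \<Rightarrow> complex \<Rightarrow> nat list \<Rightarrow> nat list \<Rightarrow> (nat \<Rightarrow> complex) \<Rightarrow> bool" where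
  "is_normal_ordering s h q rs ss c \<longleftrightarrow>
     (\<forall>k. k < hd ss \<or> k > sum_list ss \<or> V_exponent s rs ss k < 0 \<longrightarrow> c k = 0) \<and>
     UV_class s h q (H_word rs ss) =
     UV_class s h q
       (\<Sum>k = hd ss..sum_list ss. scalar (c k) * (gen_V ^ nat (V_exponent s rs ss k) * gen_U ^ k))"

definition S_coeff ::
  "nat \<Rightarrow> complex \<Rightarrow> complex \<Rightarrow> nat list \<Rightarrow> nat list \<Rightarrow> nat \<Rightarrow> complex" where
  "S_coeff s h q rs ss = (THE c. is_normal_ordering s h q rs ss c)"


section \<open>\<open>q\<close>-numbers\<close>

definition qnum :: "complex \<Rightarrow> int \<Rightarrow> complex" where
  "qnum q x = (if q = 1 then of_int x else (q powi x - 1) / (q - 1))"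

text \<open>The falling factorial
  \<open>[r m]\<^sub>q [(r - 1) m]\<^sub>q \<cdots> [(r - j + 1) m]\<^sub>q\<close> with step \<open>m\<close> (here \<open>m = 1 - s\<close>).
  It is meant for real \<open>r\<close> with \<open>r m\<close> an integer; then \<^const>\<open>floor\<close> merely
  converts the integers \<open>(r - i) m\<close> from type \<^typ>\<open>real\<close> to type \<^typ>\<open>int\<close>.\<close>

definition qfalling :: "complex \<Rightarrow> int \<Rightarrow> real \<Rightarrow> nat \<Rightarrow> complex" where
  "qfalling q m r j = (\<Prod>i<j. qnum q \<lfloor>(r - real i) * of_int m\<rfloor>)"

definition qfactorial :: "complex \<Rightarrow> int \<Rightarrow> nat \<Rightarrow> complex" where
  "qfactorial q m n = qfalling q m (real n) n"

text \<open>For \<open>j \<le> k\<close> and \<open>p\<close> either 1 or not a root of unity; otherwise the denominator may vanish.\<close>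

definition gaussian_binomial :: "complex \<Rightarrow> nat \<Rightarrow> nat \<Rightarrow> complex" where
  "gaussian_binomial p k j = qfactorial p 1 k / (qfactorial p 1 j * qfactorial p 1 (k - j))"

text \<open>The factor with index \<open>t\<close> belongs to \<open>s\<^bsub>t+1\<^esub>\<close>, as list indices start at 0.\<close>

definition Omega :: "nat \<Rightarrow> complex \<Rightarrow> nat list \<Rightarrow> nat list \<Rightarrow> nat \<Rightarrow> complex" where
  "Omega s q rs ss j =
     (\<Prod>t<length ss.
        qfalling q (1 - int s)
          (real j - real (sum_list (take t ss)) + real (sum_list (take t rs)) / (1 - real s))
          (ss ! t))"

end

theory Submission
  imports Defs
begin

text \<open>On functions \<open>f : \<int> \<rightarrow> \<complex>\<close> the operators \<open>(V f)(a) = f(a - 1)\<close> and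
  \<open>(U f)(a) = h [a + 1 - s]\<^sub>q f(a + 1 - s)\<close> satisfy the defining relation of the algebra. Applied to
  the constant function 1 and evaluated at \<open>a = (j - |s|)(1 - s) + |r|\<close>, the word
  \<open>H\<close> gives \<open>h\<^bsup>|s|\<^esup> \<Omega>[j]\<close>, while the monomial belonging to \<open>k\<close> in its normal ordering gives
  \<open>h\<^sup>k\<close> times the falling factorial of \<open>j\<close> of order \<open>k\<close>. So every normal ordering \<open>c\<close> satisfies
  \<open>h\<^bsup>|s|\<^esup> \<Omega>[j] = \<Sum>\<^sub>k c\<^sub>k h\<^sup>k [j]\<^bsup>(k)\<^esup>\<close> for all \<open>j\<close>, and \<open>q\<close>-binomial inversion determines \<open>c\<close>.
  Existence follows by multiplying from the left by one generator at a time, with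
  \<open>U V\<^sup>e = q\<^sup>e V\<^sup>e U + h [e]\<^sub>q V\<^bsup>e+s-1\<^esup>\<close>.\<close>

section \<open>\<open>q\<close>-binomial inversion\<close>

lemma prod_lessThan_rev: "(\<Prod>i<n. f (n - i)) = (\<Prod>i<n. f (Suc i))"
  for f :: "nat \<Rightarrow> 'a::comm_monoid_mult"
  by (rule prod.reindex_bij_witness[of _ "\<lambda>i. n - Suc i" "\<lambda>i. n - Suc i"]) (auto simp: Suc_diff_Suc)

section \<open>q-numbers, falling factorials and the assumption on q\<close>

lemma qnum_0 [simp]: "qnum q 0 = 0"
  by (simp add: qnum_def)

lemma qnum_1 [simp]: "qnum q 1 = 1"
  by (simp add: qnum_def)

lemma qnum_add: "q \<noteq> 0 \<Longrightarrow> qnum q (a + b) = qnum q a + q powi a * qnum q b"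
  by (simp add: qnum_def power_int_add right_diff_distrib flip: add_divide_distrib)

text \<open>The factor \<open>q powi m - 1\<close> cancels between the two quotients. If it
  vanishes, either \<open>q = 1\<close> and both sides are ordinary products, or both sides are 0.
  This turns step \<open>m\<close> in base \<open>q\<close> into step 1 in base
  \<open>q powi m\<close>.\<close>

lemma qnum_mult: "q \<noteq> 0 \<Longrightarrow> qnum q (m * x) = qnum q m * qnum (q powi m) x"
  by (cases "q powi m = 1") (auto simp: qnum_def power_int_mult)

lemma qfactorial_1_eq: "qfactorial p 1 n = (\<Prod>i<n. qnum p (int (Suc i)))"
proof -
  have "\<lfloor>real n - real i\<rfloor> = int (n - i)" if "i < n" for i
    using that by linarith
  then show ?thesis
    unfolding qfactorial_def qfalling_def prod_lessThan_rev[of "\<lambda>i. qnum p (int i)", symmetric]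
    by (intro prod.cong) simp_all
qed

lemma qfalling_of_nat:
  "qfalling q m (real j) k = (\<Prod>i<k. qnum q ((int j - int i) * m))"
proof -
  have "\<lfloor>(real j - real i) * real_of_int m\<rfloor> = (int j - int i) * m" for i
  proof -
    have "(real j - real i) * real_of_int m = real_of_int ((int j - int i) * m)" by simp
    then show ?thesis by (simp only: floor_of_int)
  qed
  then show ?thesis
    by (simp add: qfalling_def)
qed

text \<open>The factor with index \<open>j\<close> is \<open>qnum q 0\<close>. This makes the linear
  system for the coefficients triangular.\<close>

lemma qfalling_of_nat_eq_0: "j < k \<Longrightarrow> qfalling q m (real j) k = 0"
  by (auto simp: qfalling_of_nat intro!: prod_zero bexI[of _ j])

text \<open>Each of the \<open>k\<close> factors releases one \<open>qnum q m\<close> by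
  \<open>qnum_mult\<close>; what is left completes the smaller factorial to the larger one.\<close>

lemma qfalling_of_nat_qfactorial:
  assumes "q \<noteq> 0" "k \<le> j"
  shows "qfalling q m (real j) k * qfactorial (q powi m) 1 (j - k) =
    qnum q m ^ k * qfactorial (q powi m) 1 j"
proof -
  let ?p = "q powi m"
  have "(\<Prod>i<k. qnum ?p (int j - int i)) * qfactorial ?p 1 (j - k) = qfactorial ?p 1 j"
    using assms(2)
  proof (induction k)
    case (Suc k)
    have "j - k = Suc (j - Suc k)" "int (Suc (j - Suc k)) = int j - int k" using Suc.prems by auto
    then have "qfactorial ?p 1 (j - k) = qnum ?p (int j - int k) * qfactorial ?p 1 (j - Suc k)"
      by (simp only: qfactorial_1_eq prod.lessThan_Suc mult.commute)
    then show ?case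
      using Suc by (simp add: mult.assoc)
  qed simp
  moreover have "qnum q ((int j - int i) * m) = qnum q m * qnum ?p (int j - int i)" for i
    using qnum_mult[OF assms(1)] by (metis mult.commute)
  then have "qfalling q m (real j) k = qnum q m ^ k * (\<Prod>i<k. qnum ?p (int j - int i))"
    by (simp add: qfalling_of_nat prod.distrib)
  ultimately show ?thesis by (simp add: mult.assoc)
qed

lemma qfactorial_eq:
  assumes "q \<noteq> 0"
  shows "qfactorial q m k = qnum q m ^ k * qfactorial (q powi m) 1 k"
proof -
  have "qfactorial (q powi m) 1 0 = 1" by (simp add: qfactorial_1_eq)
  then show ?thesis
    using qfalling_of_nat_qfactorial[OF assms order_refl, of m k] by (simp add: qfactorial_def)
qed

text \<open>The assumption on \<open>q\<close>, stated as a predicate because it is also needed for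
  the base \<open>q powi (1 - int s)\<close>.\<close>

definition one_or_no_root_of_unity :: "complex \<Rightarrow> bool" where
  "one_or_no_root_of_unity p \<longleftrightarrow> p \<noteq> 0 \<and> (p = 1 \<or> (\<forall>m>0. p ^ m \<noteq> 1))"

lemma qnum_nonzero:
  assumes "one_or_no_root_of_unity p" "x \<noteq> 0"
  shows "qnum p x \<noteq> 0"
proof (cases "p = 1")
  case False
  have "p powi x \<noteq> 1"
  proof
    assume "p powi x = 1"
    then have "p ^ nat \<bar>x\<bar> = 1"
      by (auto simp: power_int_def power_inverse abs_if split: if_splits)
    then show False
      using assms False by (auto simp: one_or_no_root_of_unity_def)
  qed
  then show ?thesis using False by (simp add: qnum_def)
qed (use assms in \<open>simp add: qnum_def\<close>)

text \<open>If \<open>(q powi m) ^ k\<close> were 1 for \<open>q\<close> other than 1 and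
  \<open>k > 0\<close>, the q-number of the nonzero integer \<open>m * int k\<close> would
  vanish.\<close>

lemma one_or_no_root_of_unity_powi:
  assumes "one_or_no_root_of_unity q" "m \<noteq> 0"
  shows "one_or_no_root_of_unity (q powi m)"
proof -
  have "(q powi m) ^ k \<noteq> 1" if "q \<noteq> 1" "k > 0" for k
    using qnum_nonzero[of q "m * int k"] assms that
    by (simp add: qnum_def power_int_power')
  then show ?thesis
    using assms by (cases "q = 1") (auto simp: one_or_no_root_of_unity_def)
qed

lemma qfactorial_1_nonzero: "one_or_no_root_of_unity p \<Longrightarrow> qfactorial p 1 n \<noteq> 0"
  unfolding qfactorial_1_eq using qnum_nonzero[of p] by (simp add: prod_zero_iff)

section \<open>Gaussian binomial coefficients\<close>

lemma gaussian_binomial_0 [simp]: "one_or_no_root_of_unity p \<Longrightarrow> gaussian_binomial p n 0 = 1"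
  using qfactorial_1_nonzero[of p n] by (simp add: gaussian_binomial_def qfactorial_1_eq)

lemma gaussian_binomial_self [simp]: "one_or_no_root_of_unity p \<Longrightarrow> gaussian_binomial p n n = 1"
  using qfactorial_1_nonzero[of p n] by (simp add: gaussian_binomial_def qfactorial_1_eq)

text \<open>After clearing factorials this is \<open>qnum_add\<close> for the splitting of
  \<open>n + 1\<close> into \<open>m + 1\<close> and \<open>n - m\<close>. With \<open>m < n\<close>
  the truncated subtractions are exact.\<close>

lemma gaussian_binomial_Suc_Suc:
  assumes p: "one_or_no_root_of_unity p" and "m < n"
  shows "gaussian_binomial p (Suc n) (Suc m) =
    gaussian_binomial p n m + p ^ Suc m * gaussian_binomial p n (Suc m)"
proof -
  obtain d where n: "n = Suc (m + d)"
    using \<open>m < n\<close> less_iff_Suc_add by auto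
  let ?F = "qfactorial p 1"
  have F_Suc: "?F (Suc k) = ?F k * qnum p (int (Suc k))" for k
    by (simp add: qfactorial_1_eq)
  have "int (Suc n) = int (Suc m) + int (Suc d)" using n by simp
  then have "qnum p (int (Suc n)) = qnum p (int (Suc m)) + p ^ Suc m * qnum p (int (Suc d))"
    using qnum_add[of p "int (Suc m)" "int (Suc d)"] p
    by (metis one_or_no_root_of_unity_def power_int_of_nat)
  moreover have nz: "?F k \<noteq> 0" "qnum p (int (Suc k)) \<noteq> 0" for k
    using p qfactorial_1_nonzero qnum_nonzero[of p "int (Suc k)"] by auto
  moreover have "n - m = Suc d" "n - Suc m = d" "Suc n - Suc m = Suc d"
    using n by auto
  ultimately show ?thesis
    unfolding gaussian_binomial_def F_Suc[of n] F_Suc[of m]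
    using nz[of m] nz[of d] by (simp only: F_Suc) (simp add: field_simps)
qed

lemma gaussian_binomial_alternating_sum:
  assumes p: "one_or_no_root_of_unity p" and "n > 0"
  shows "(\<Sum>m\<le>n. (-1) ^ m * p ^ (m choose 2) * gaussian_binomial p n m) = 0"
proof -
  obtain N where n: "n = Suc N" using \<open>n > 0\<close> gr0_implies_Suc by auto
  \<comment> \<open>Pascal's rule makes the alternating sum telescope.\<close>
  define A where "A m = (-1) ^ m * p ^ (Suc m choose 2) * gaussian_binomial p N m" for m
  have choose: "Suc (Suc m) choose 2 = Suc m + (Suc m choose 2)" for m
    by (simp add: numeral_2_eq_2)
  \<comment> \<open>Both end terms are split off because Pascal's rule covers only the inner
    indices; they later cancel against \<open>A 0\<close> and \<open>A N\<close>.\<close>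
  have split: "(\<Sum>m\<le>Suc N. f m) = f 0 + (\<Sum>m<N. f (Suc m)) + f (Suc N)" for f :: "nat \<Rightarrow> complex"
    unfolding sum.atMost_Suc unfolding lessThan_Suc_atMost[symmetric] sum.lessThan_Suc_shift ..
  have "(\<Sum>m\<le>n. (-1) ^ m * p ^ (m choose 2) * gaussian_binomial p n m) =
      1 + (\<Sum>m<N. (-1) ^ Suc m * p ^ (Suc m choose 2) * gaussian_binomial p (Suc N) (Suc m))
      + (-1) ^ Suc N * p ^ (Suc N choose 2)"
    unfolding n split using p by (simp add: binomial_eq_0)
  also have "(\<Sum>m<N. (-1) ^ Suc m * p ^ (Suc m choose 2) * gaussian_binomial p (Suc N) (Suc m)) =
      (\<Sum>m<N. A (Suc m) - A m)"
  proof (rule sum.cong[OF refl])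
    fix m assume "m \<in> {..<N}"
    then show "(-1) ^ Suc m * p ^ (Suc m choose 2) * gaussian_binomial p (Suc N) (Suc m) = A (Suc m) - A m"
      using p by (simp add: A_def gaussian_binomial_Suc_Suc choose power_add algebra_simps)
  qed
  also have "\<dots> = A N - A 0" by (rule sum_lessThan_telescope)
  finally show ?thesis using p by (simp add: A_def binomial_eq_0)
qed

text \<open>Both sides are the q-trinomial coefficient with lower entries \<open>l\<close>,
  \<open>j - l\<close> and \<open>k - j\<close>.\<close>

lemma gaussian_binomial_mult:
  assumes "one_or_no_root_of_unity p" "l \<le> j" "j \<le> k"
  shows "gaussian_binomial p k j * gaussian_binomial p j l =
    gaussian_binomial p k l * gaussian_binomial p (k - l) (k - j)"
  using assms(2,3) qfactorial_1_nonzero[OF assms(1)]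
  by (simp add: gaussian_binomial_def field_simps)

text \<open>Insert \<open>b\<close> and exchange the sums. By \<open>gaussian_binomial_mult\<close>
  the coefficient of \<open>d l\<close> is a multiple of an alternating sum of order
  \<open>k - l\<close>, which vanishes unless \<open>l = k\<close>.\<close>

lemma gaussian_binomial_inversion:
  assumes p: "one_or_no_root_of_unity p"
    and b: "\<And>j. j \<le> k \<Longrightarrow> b j = (\<Sum>l\<le>j. gaussian_binomial p j l * d l)"
  shows "(\<Sum>j\<le>k. (-1) ^ (k - j) * p ^ ((k - j) choose 2) * gaussian_binomial p k j * b j) = d k"
proof -
  let ?G = "gaussian_binomial p"
  have "(\<Sum>j\<le>k. (-1) ^ (k - j) * p ^ ((k - j) choose 2) * ?G k j * b j) =
      (\<Sum>j\<le>k. \<Sum>l\<le>j. (-1) ^ (k - j) * p ^ ((k - j) choose 2) * (?G k j * ?G j l) * d l)"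
    by (intro sum.cong refl) (simp add: b sum_distrib_left mult.assoc)
  also have "\<dots> = (\<Sum>l\<le>k. \<Sum>j=l..k. (-1) ^ (k - j) * p ^ ((k - j) choose 2) * (?G k j * ?G j l) * d l)"
    unfolding sum.Sigma[OF finite_atMost ballI[OF finite_atMost]]
      sum.Sigma[OF finite_atMost ballI[OF finite_atLeastAtMost]]
    by (rule sum.reindex_bij_witness[of _ "\<lambda>(l, j). (j, l)" "\<lambda>(j, l). (l, j)"]) auto
  also have "\<dots> = (\<Sum>l\<le>k. if l = k then d k else 0)"
  proof (rule sum.cong[OF refl])
    fix l assume "l \<in> {..k}"
    have "(\<Sum>j=l..k. (-1) ^ (k - j) * p ^ ((k - j) choose 2) * (?G k j * ?G j l) * d l) =
        (\<Sum>m\<le>k - l. (?G k l * d l) * ((-1) ^ m * p ^ (m choose 2) * ?G (k - l) m))"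
      by (rule sum.reindex_bij_witness[of _ "\<lambda>m. k - m" "\<lambda>j. k - j"])
        (use \<open>l \<in> _\<close> in \<open>auto simp: gaussian_binomial_mult[OF p]\<close>)
    also have "\<dots> = (if l = k then d k else 0)"
      using p \<open>l \<in> _\<close> gaussian_binomial_alternating_sum[OF p, of "k - l"]
      by (simp add: binomial_eq_0 flip: sum_distrib_left)
    finally show "(\<Sum>j=l..k. (-1) ^ (k - j) * p ^ ((k - j) choose 2) * (?G k j * ?G j l) * d l) =
      (if l = k then d k else 0)" .
  qed
  finally show ?thesis by simp
qed

section \<open>Congruence modulo the relation\<close>

lemma a_inv_free_UV_ring: "\<ominus>\<^bsub>free_UV_ring\<^esub> x = - x"
proof -
  interpret ring free_UV_ring by (rule ring_free_UV_ring)
  show ?thesis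
    by (rule minus_equality) (simp_all add: free_UV_ring_def)
qed

lemma UV_class_eq_iff:
  "UV_class s h q x = UV_class s h q y \<longleftrightarrow> x - y \<in> UV_ideal s h q"
proof -
  interpret ring free_UV_ring by (rule ring_free_UV_ring)
  have "x \<ominus>\<^bsub>free_UV_ring\<^esub> y = x - y"
    unfolding a_minus_def a_inv_free_UV_ring by (simp add: free_UV_ring_def)
  then show ?thesis
    using quotient_eq_iff_same_a_r_cos[OF ideal_UV_ideal, of x y s h q]
    by (simp add: UV_class_def free_UV_ring_def)
qed

context
  fixes s :: nat and h q :: complex
begin

text \<open>Equality of classes, by \<open>UV_class_eq_iff\<close>, expressed on representatives so
  that calculations stay in the free algebra.\<close>

definition UV_cong :: "free_UV \<Rightarrow> free_UV \<Rightarrow> bool" (infix "\<approx>" 50) where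
  "x \<approx> y \<longleftrightarrow> x - y \<in> UV_ideal s h q"

lemma UV_ideal_closed:
  shows UV_ideal_0: "0 \<in> UV_ideal s h q"
    and UV_ideal_add: "x \<in> UV_ideal s h q \<Longrightarrow> y \<in> UV_ideal s h q \<Longrightarrow> x + y \<in> UV_ideal s h q"
    and UV_ideal_mult_left: "x \<in> UV_ideal s h q \<Longrightarrow> z * x \<in> UV_ideal s h q"
    and UV_ideal_mult_right: "x \<in> UV_ideal s h q \<Longrightarrow> x * z \<in> UV_ideal s h q"
proof -
  interpret ideal "UV_ideal s h q" free_UV_ring by (rule ideal_UV_ideal)
  show "0 \<in> UV_ideal s h q"
    using additive_subgroup.zero_closed[OF additive_subgroup_axioms] by (simp add: free_UV_ring_def)
  show "x \<in> UV_ideal s h q \<Longrightarrow> y \<in> UV_ideal s h q \<Longrightarrow> x + y \<in> UV_ideal s h q"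
    using additive_subgroup.a_closed[OF additive_subgroup_axioms, of x y] by (simp add: free_UV_ring_def)
  show "x \<in> UV_ideal s h q \<Longrightarrow> z * x \<in> UV_ideal s h q"
    using I_l_closed[of x z] by (simp add: free_UV_ring_def)
  show "x \<in> UV_ideal s h q \<Longrightarrow> x * z \<in> UV_ideal s h q"
    using I_r_closed[of x z] by (simp add: free_UV_ring_def)
qed

lemma UV_cong_refl [simp, intro]: "x \<approx> x"
  by (simp add: UV_cong_def UV_ideal_0)

lemma UV_cong_trans [trans]: "x \<approx> y \<Longrightarrow> y \<approx> z \<Longrightarrow> x \<approx> z"
  unfolding UV_cong_def using UV_ideal_add[of "x - y" "y - z"] by simp

lemma UV_cong_add: "x \<approx> x' \<Longrightarrow> y \<approx> y' \<Longrightarrow> x + y \<approx> x' + y'"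
  unfolding UV_cong_def using UV_ideal_add[of "x - x'" "y - y'"] by (simp add: algebra_simps)

lemma UV_cong_mult_left: "x \<approx> y \<Longrightarrow> z * x \<approx> z * y"
  unfolding UV_cong_def using UV_ideal_mult_left[of "x - y" z] by (simp add: algebra_simps)

lemma UV_cong_mult_right: "x \<approx> y \<Longrightarrow> x * z \<approx> y * z"
  unfolding UV_cong_def using UV_ideal_mult_right[of "x - y" z] by (simp add: algebra_simps)

lemma UV_cong_sum: "(\<And>i. i \<in> A \<Longrightarrow> f i \<approx> g i) \<Longrightarrow> sum f A \<approx> sum g A"
  by (induction A rule: infinite_finite_induct) (auto intro: UV_cong_add)

lemma gen_UV_relation: "gen_U * gen_V \<approx> scalar q * (gen_V * gen_U) + scalar h * gen_V ^ s"
proof -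
  let ?x = "gen_U * gen_V - scalar q * (gen_V * gen_U) - scalar h * gen_V ^ s"
  have "?x \<in> UV_ideal s h q"
    unfolding UV_ideal_def
    by (rule ring.genideal_self'[OF ring_free_UV_ring]) (simp add: free_UV_ring_def)
  then show ?thesis by (simp add: UV_cong_def diff_diff_eq)
qed

end

text \<open>Supports are finite, so additive identities need checking only on scalar multiples of
  single words.\<close>

lemma poly_mapping_single_plus_induct [case_names single plus]:
  assumes "\<And>k v. P (Poly_Mapping.single k v)"
    and plus: "\<And>x y. P x \<Longrightarrow> P y \<Longrightarrow> P (x + y)"
  shows "P x"
proof (induction x rule: update_induct)
  case const
  show ?case using assms(1)[of _ 0] by simp
next
  case (update f a b)
  \<comment> \<open>Here \<open>a\<close> is not yet a key of \<open>f\<close>, so updating is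
    adding.\<close>
  have "Poly_Mapping.update a b f = f + Poly_Mapping.single a b"
    using update(1)
    by (intro poly_mapping_eqI)
      (auto simp: Poly_Mapping.lookup_update lookup_add lookup_single when_def in_keys_iff)
  then show ?case using plus[OF update(3) assms(1)] by simp
qed

lemma scalar_simps:
  shows scalar_0: "scalar 0 = 0"
    and scalar_1: "scalar 1 = 1"
    and scalar_add: "scalar (a + b) = scalar a + scalar b"
    and scalar_mult: "scalar (a * b) = scalar a * scalar b"
  by (simp_all add: scalar_def single_add mult_single)

lemma scalar_commute: "x * scalar c = scalar c * x"
  by (induction x rule: poly_mapping_single_plus_induct)
    (simp_all add: scalar_def mult_single mult.commute distrib_left distrib_right)

lemma scalar_left_commute: "x * (scalar c * y) = scalar c * (x * y)"
  by (metis mult.assoc scalar_commute)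

section \<open>Existence of the normal ordering\<close>

lemma H_word_snoc:
  "length rs = length ss \<Longrightarrow>
    H_word (rs @ [r]) (ss @ [t]) = gen_V ^ r * (gen_U ^ t * H_word rs ss)"
  by (simp add: H_word_def mult.assoc)

context
  fixes s :: nat and h q :: complex
begin

text \<open>\<open>is_normal_ordering\<close> with free parameters for the lower bound,
  \<open>|r|\<close> and \<open>|s|\<close>, so that it also applies to intermediate products such
  as \<open>gen_U * x\<close>.\<close>

definition normal_form :: "nat \<Rightarrow> nat \<Rightarrow> nat \<Rightarrow> free_UV \<Rightarrow> (nat \<Rightarrow> complex) \<Rightarrow> bool" where
  "normal_form a R S x c \<longleftrightarrow>
     (\<forall>k. k < a \<or> k > S \<or> int R - (int S - int k) * (1 - int s) < 0 \<longrightarrow> c k = 0) \<and>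
     UV_cong s h q x (\<Sum>k=a..S.
       scalar (c k) * (gen_V ^ nat (int R - (int S - int k) * (1 - int s)) * gen_U ^ k))"

lemma is_normal_ordering_iff:
  "is_normal_ordering s h q rs ss c \<longleftrightarrow>
    normal_form (hd ss) (sum_list rs) (sum_list ss) (H_word rs ss) c"
  by (simp add: is_normal_ordering_def normal_form_def UV_class_eq_iff UV_cong_def V_exponent_def)

lemma normal_form_gen_V_mult:
  assumes "normal_form a R S x c"
  shows "normal_form a (Suc R) S (gen_V * x) c"
proof -
  let ?e = "\<lambda>R k. int R - (int S - int k) * (1 - int s)"
  have e: "?e (Suc R) k = ?e R k + 1" for k by simp
  have supp: "c k = 0" if "k < a \<or> k > S \<or> ?e R k < 0" for k
    using assms that unfolding normal_form_def by blast
  have "gen_V * (scalar (c k) * (gen_V ^ nat (?e R k) * gen_U ^ k)) =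
      scalar (c k) * (gen_V ^ nat (?e (Suc R) k) * gen_U ^ k)" for k
  \<comment> \<open>At a negative exponent \<open>nat\<close> would break the shift by one, but
    there the coefficient is 0.\<close>
  proof (cases "?e R k < 0")
    case False
    then have "nat (?e (Suc R) k) = Suc (nat (?e R k))" unfolding e by linarith
    then show ?thesis by (simp add: scalar_left_commute[of gen_V] mult.assoc)
  qed (simp add: supp scalar_simps)
  then have "gen_V * (\<Sum>k=a..S. scalar (c k) * (gen_V ^ nat (?e R k) * gen_U ^ k)) =
      (\<Sum>k=a..S. scalar (c k) * (gen_V ^ nat (?e (Suc R) k) * gen_U ^ k))"
    by (simp only: sum_distrib_left)
  moreover have "UV_cong s h q (gen_V * x)
      (gen_V * (\<Sum>k=a..S. scalar (c k) * (gen_V ^ nat (?e R k) * gen_U ^ k)))"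
    using assms unfolding normal_form_def by (intro UV_cong_mult_left) blast
  moreover have "c k = 0" if "k < a \<or> k > S \<or> ?e (Suc R) k < 0" for k
    by (rule supp) (use that in \<open>unfold e, linarith\<close>)
  ultimately show ?thesis unfolding normal_form_def by auto
qed

lemma normal_form_V_power_mult:
  "normal_form a R S x c \<Longrightarrow> normal_form a (R + r) S (gen_V ^ r * x) c"
  by (induction r) (auto simp: mult.assoc dest: normal_form_gen_V_mult)

lemma normal_form_V_power_U_power:
  "normal_form b a b (gen_V ^ a * gen_U ^ b) (\<lambda>k. if k = b then 1 else 0)"
  unfolding normal_form_def by (auto simp: scalar_1)

context
  assumes q: "q \<noteq> 0"
begin

text \<open>Each further \<open>gen_V\<close> contributes \<open>h * q ^ e\<close>, and
  \<open>qnum\<close> satisfies the same recursion. When \<open>e = s = 0\<close> the exponent is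
  truncated, but its coefficient is 0.\<close>

lemma gen_U_mult_gen_V_power:
  "UV_cong s h q (gen_U * gen_V ^ e)
    (scalar (q ^ e) * (gen_V ^ e * gen_U) +
     scalar (h * qnum q (int e)) * gen_V ^ nat (int e + int s - 1))"
proof (induction e)
  case 0
  then show ?case by (simp add: scalar_simps)
next
  case (Suc e)
  let ?a = "q ^ e" and ?b = "h * qnum q (int e)" and ?m = "nat (int e + int s - 1)"
  have b: "scalar ?b * (gen_V ^ ?m * gen_V) = scalar ?b * gen_V ^ (e + s)"
  proof (cases e)
    case (Suc e')
    then have "e + s = Suc ?m" by linarith
    then show ?thesis by (simp add: power_commutes)
  qed (simp add: scalar_simps)
  have "gen_U * gen_V ^ Suc e = (gen_U * gen_V ^ e) * gen_V"
    by (simp add: power_commutes mult.assoc)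
  also have "UV_cong s h q \<dots> ((scalar ?a * (gen_V ^ e * gen_U) + scalar ?b * gen_V ^ ?m) * gen_V)"
    by (rule UV_cong_mult_right[OF Suc])
  also have "\<dots> = scalar ?a * (gen_V ^ e * (gen_U * gen_V)) + scalar ?b * gen_V ^ (e + s)"
    using b by (simp add: distrib_right mult.assoc)
  also have "UV_cong s h q \<dots> (scalar ?a * (gen_V ^ e * (scalar q * (gen_V * gen_U) + scalar h * gen_V ^ s))
      + scalar ?b * gen_V ^ (e + s))"
    by (intro UV_cong_add UV_cong_mult_left gen_UV_relation UV_cong_refl)
  also have "\<dots> = (scalar ?a * scalar q) * (gen_V ^ e * gen_V * gen_U) +
      (scalar ?a * scalar h + scalar ?b) * gen_V ^ (e + s)"
    by (simp add: distrib_left distrib_right mult.assoc scalar_left_commute[of "gen_V ^ e"] power_add)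
  also have "scalar ?a * scalar q = scalar (q ^ Suc e)"
    by (simp only: power_Suc2 scalar_simps)
  also have "scalar ?a * scalar h + scalar ?b = scalar (h * qnum q (int (Suc e)))"
    using qnum_add[OF q, of "int e" 1] by (simp flip: scalar_simps add: algebra_simps)
  finally show ?case by (simp add: power_commutes mult.assoc nat_int_add)
qed

text \<open>Moving \<open>gen_U\<close> past the V-power sends the term of index \<open>k\<close>
  partly to \<open>k + 1\<close> with the same V-exponent, partly to \<open>k\<close> with the
  exponent raised by \<open>s - 1\<close>. Both fit the exponent pattern for
  \<open>Suc S\<close>.\<close>

lemma normal_form_gen_U_mult:
  assumes "normal_form a R S x c" "a \<le> S"
  shows "\<exists>c'. normal_form a R (Suc S) (gen_U * x) c'"
proof -
  let ?e = "\<lambda>S k. int R - (int S - int k) * (1 - int s)"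
  have e_Suc: "?e (Suc S) (Suc k) = ?e S k" and e: "?e (Suc S) k = ?e S k + int s - 1" for k
    by (simp_all add: algebra_simps)
  have supp: "c k = 0" if "k < a \<or> k > S \<or> ?e S k < 0" for k
    using assms that unfolding normal_form_def by blast
  \<comment> \<open>\<open>c1 k\<close> is what index \<open>k\<close> passes on to
    \<open>k + 1\<close>, \<open>c2 k\<close> what stays at \<open>k\<close>.\<close>
  define c1 where "c1 k = c k * q ^ nat (?e S k)" for k
  define c2 where "c2 k = c k * (h * qnum q (?e S k))" for k
  define c' where "c' k = (case k of 0 \<Rightarrow> 0 | Suc l \<Rightarrow> c1 l) + c2 k" for k
  let ?M = "\<lambda>S k. gen_V ^ nat (?e S k) * gen_U ^ k"
  have c2_0: "c2 k = 0" if "k < a \<or> k > S \<or> ?e (Suc S) k < 0" for k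
  proof (cases "k < a \<or> k > S \<or> ?e S k < 0")
    case False
    then have "?e S k + int s - 1 < 0" "?e S k \<ge> 0" using that e[of k] by auto
    then have "?e S k = 0" by linarith \<comment> \<open>possible only for \<open>s = 0\<close>\<close>
    then show ?thesis by (simp only: c2_def qnum_0 mult_zero_right)
  qed (simp add: c2_def supp)
  have c'_0: "c' k = 0" if "k < a \<or> k > Suc S \<or> ?e (Suc S) k < 0" for k
  proof (cases k)
    case (Suc l)
    have "c l = 0" by (rule supp) (use that in \<open>unfold Suc e_Suc, linarith\<close>)
    moreover have "c2 k = 0" by (rule c2_0) (use that in linarith)
    ultimately show ?thesis by (simp add: c'_def c1_def Suc)
  next
    case 0
    have "c2 k = 0" by (rule c2_0) (use that in linarith)
    then show ?thesis by (simp add: c'_def 0)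
  qed
  have step: "UV_cong s h q (gen_U * (scalar (c k) * ?M S k))
      (scalar (c1 k) * ?M (Suc S) (Suc k) + scalar (c2 k) * ?M (Suc S) k)" for k
  proof (cases "?e S k < 0")
    case True
    then show ?thesis by (simp add: supp c1_def c2_def scalar_simps)
  next
    case False
    define m where "m = nat (?e S k)"
    have m: "?e S k = int m" using False by (simp add: m_def)
    have "gen_U * (scalar (c k) * ?M S k) = scalar (c k) * (gen_U * gen_V ^ m) * gen_U ^ k"
      by (simp add: m scalar_left_commute[of gen_U] mult.assoc)
    also have "UV_cong s h q \<dots> (scalar (c k) * (scalar (q ^ m) * (gen_V ^ m * gen_U) +
        scalar (h * qnum q (int m)) * gen_V ^ nat (int m + int s - 1)) * gen_U ^ k)"
      by (intro UV_cong_mult_right UV_cong_mult_left gen_U_mult_gen_V_power)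
    also have "\<dots> = scalar (c1 k) * ?M (Suc S) (Suc k) + scalar (c2 k) * ?M (Suc S) k"
      unfolding e_Suc unfolding e m c1_def c2_def
      by (simp add: scalar_mult distrib_left distrib_right mult.assoc power_commutes)
    finally show ?thesis .
  qed
  have "UV_cong s h q (gen_U * x) (gen_U * (\<Sum>k=a..S. scalar (c k) * ?M S k))"
    using assms unfolding normal_form_def by (intro UV_cong_mult_left) blast
  also have "gen_U * (\<Sum>k=a..S. scalar (c k) * ?M S k) =
      (\<Sum>k=a..S. gen_U * (scalar (c k) * ?M S k))"
    by (rule sum_distrib_left)
  also have "UV_cong s h q \<dots>
      (\<Sum>k=a..S. scalar (c1 k) * ?M (Suc S) (Suc k) + scalar (c2 k) * ?M (Suc S) k)"
    by (intro UV_cong_sum step)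
  also have "\<dots> = (\<Sum>k=a..S. scalar (c1 k) * ?M (Suc S) (Suc k)) +
      (\<Sum>k=a..S. scalar (c2 k) * ?M (Suc S) k)"
    by (rule sum.distrib)
  also have "(\<Sum>k=a..S. scalar (c1 k) * ?M (Suc S) (Suc k)) =
      (\<Sum>k=a..Suc S. scalar (case k of 0 \<Rightarrow> 0 | Suc l \<Rightarrow> c1 l) * ?M (Suc S) k)"
  proof -
    \<comment> \<open>Nothing reaches the lowest index from below: for \<open>a > 0\<close> the
      predecessor of \<open>a\<close> lies outside the support of \<open>c\<close>.\<close>
    have "(case a of 0 \<Rightarrow> 0 | Suc l \<Rightarrow> c1 l) = 0"
      by (auto simp: c1_def supp split: nat.split)
    then show ?thesis
      using \<open>a \<le> S\<close>
      by (simp add: sum.atLeast_Suc_atMost[of a "Suc S"] sum.shift_bounds_cl_Suc_ivl scalar_0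
        del: sum.cl_ivl_Suc)
  qed
  also have "(\<Sum>k=a..S. scalar (c2 k) * ?M (Suc S) k) = (\<Sum>k=a..Suc S. scalar (c2 k) * ?M (Suc S) k)"
    using c2_0[of "Suc S"] by (simp add: scalar_0)
  also have "(\<Sum>k=a..Suc S. scalar (case k of 0 \<Rightarrow> 0 | Suc l \<Rightarrow> c1 l) * ?M (Suc S) k) + \<dots> =
      (\<Sum>k=a..Suc S. scalar (c' k) * ?M (Suc S) k)"
    by (simp only: c'_def scalar_add distrib_right sum.distrib)
  finally show ?thesis
    unfolding normal_form_def using c'_0 by blast
qed

lemma normal_form_U_power_mult:
  assumes "normal_form a R S x c" "a \<le> S"
  shows "\<exists>c'. normal_form a R (S + t) (gen_U ^ t * x) c'"
proof (induction t)
  case (Suc t)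
  then obtain c' where "normal_form a R (S + t) (gen_U ^ t * x) c'" by blast
  from normal_form_gen_U_mult[OF this] \<open>a \<le> S\<close> show ?case by (simp add: mult.assoc)
qed (use assms in auto)

lemma normal_form_H_word:
  assumes "length rs = length ss" "ss \<noteq> []"
  shows "\<exists>c. normal_form (hd ss) (sum_list rs) (sum_list ss) (H_word rs ss) c"
  using assms
proof (induction rs ss rule: rev_induct2)
  case (4 r rs t ss)
  show ?case
  proof (cases "ss = []")
    \<comment> \<open>A single factor is already normally ordered; it fixes the lower bound, since
      \<open>hd ss\<close> stays the same when the lists grow at the end.\<close>
    case True
    then show ?thesis
      using 4 normal_form_V_power_U_power[of t r] by (auto simp: H_word_def)
  next
    case False
    then obtain c where "normal_form (hd ss) (sum_list rs) (sum_list ss) (H_word rs ss) c"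
      using 4 by auto
    moreover have "hd ss \<le> sum_list ss" using False by (cases ss) auto
    ultimately obtain c' where
      "normal_form (hd ss) (sum_list rs) (sum_list ss + t) (gen_U ^ t * H_word rs ss) c'"
      using normal_form_U_power_mult by blast
    from normal_form_V_power_mult[OF this, of r] show ?thesis
      using 4 False by (auto simp: H_word_snoc)
  qed
qed auto

end

end

section \<open>A representation on functions\<close>

context
  fixes s :: nat and h q :: complex
begin

text \<open>If \<open>f\<close> lists the coefficients of a formal two-sided series in
  \<open>x\<close>, then \<open>V\<close> is multiplication by \<open>x\<close> and \<open>U\<close>
  is \<open>h\<close> times \<open>x ^ s\<close> times the q-derivative.\<close>

primrec letter_op :: "letter \<Rightarrow> (int \<Rightarrow> complex) \<Rightarrow> int \<Rightarrow> complex" where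
  "letter_op Letter_V f = (\<lambda>a. f (a - 1))"
| "letter_op Letter_U f = (\<lambda>a. h * qnum q (a + (1 - int s)) * f (a + (1 - int s)))"

definition word_op :: "word \<Rightarrow> (int \<Rightarrow> complex) \<Rightarrow> int \<Rightarrow> complex" where
  "word_op w = foldr letter_op (letters w)"

definition UV_op :: "free_UV \<Rightarrow> (int \<Rightarrow> complex) \<Rightarrow> int \<Rightarrow> complex" where
  "UV_op x f a = (\<Sum>w\<in>Poly_Mapping.keys x. Poly_Mapping.lookup x w * word_op w f a)"

lemma word_op_0: "word_op 0 f = f"
  by (simp add: word_op_def zero_word_def)

lemma word_op_plus: "word_op (v + w) f = word_op v (word_op w f)"
  by (simp add: word_op_def plus_word_def)

lemma word_op_add: "word_op w (\<lambda>a. f a + g a) = (\<lambda>a. word_op w f a + word_op w g a)"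
proof -
  have "letter_op l (\<lambda>a. f a + g a) = (\<lambda>a. letter_op l f a + letter_op l g a)" for l f g
    by (cases l) (simp_all add: distrib_left)
  then have "foldr letter_op ls (\<lambda>a. f a + g a) =
      (\<lambda>a. foldr letter_op ls f a + foldr letter_op ls g a)" for ls
    by (induction ls) simp_all
  then show ?thesis by (simp add: word_op_def)
qed

lemma word_op_scale: "word_op w (\<lambda>a. c * f a) = (\<lambda>a. c * word_op w f a)"
proof -
  have "letter_op l (\<lambda>a. c * f a) = (\<lambda>a. c * letter_op l f a)" for l f
    by (cases l) (simp_all add: mult.left_commute)
  then have "foldr letter_op ls (\<lambda>a. c * f a) = (\<lambda>a. c * foldr letter_op ls f a)" for ls
    by (induction ls) simp_all
  then show ?thesis by (simp add: word_op_def)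
qed

section \<open>Linearity and multiplicativity of the representation\<close>

lemma UV_op_0: "UV_op 0 f = (\<lambda>a. 0)"
  by (simp add: UV_op_def fun_eq_iff)

lemma UV_op_single: "UV_op (Poly_Mapping.single w c) f = (\<lambda>a. c * word_op w f a)"
  by (simp add: UV_op_def fun_eq_iff)

lemma UV_op_add: "UV_op (x + y) f = (\<lambda>a. UV_op x f a + UV_op y f a)"
  unfolding UV_op_def
  by (subst setsum_keys_plus_distrib) (simp_all add: distrib_right)

lemma UV_op_add_fun: "UV_op x (\<lambda>a. f a + g a) = (\<lambda>a. UV_op x f a + UV_op x g a)"
  by (simp add: UV_op_def fun_eq_iff word_op_add distrib_left sum.distrib)

text \<open>By additivity in both arguments single words suffice, and \<open>foldr\<close> turns
  concatenation into composition.\<close>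

lemma UV_op_mult: "UV_op (x * y) f = UV_op x (UV_op y f)"
proof (induction x rule: poly_mapping_single_plus_induct)
  case (single v c)
  show ?case
  proof (induction y rule: poly_mapping_single_plus_induct)
    case (single w d)
    show ?case
      by (simp add: mult_single UV_op_single word_op_plus word_op_scale mult.assoc)
  next
    case (plus y z)
    then show ?case by (simp add: distrib_left UV_op_add UV_op_add_fun)
  qed
next
  case (plus x z)
  then show ?case by (simp add: distrib_right UV_op_add)
qed

lemma UV_op_scalar: "UV_op (scalar c) f = (\<lambda>a. c * f a)"
  by (simp add: scalar_def UV_op_single word_op_0)

lemma UV_op_1: "UV_op 1 f = f"
  using UV_op_scalar[of 1] by (simp add: scalar_1)

lemma UV_op_uminus: "UV_op (- x) f = (\<lambda>a. - UV_op x f a)"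
  using UV_op_add[of x "- x" f] by (simp add: UV_op_0 fun_eq_iff eq_neg_iff_add_eq_0 add.commute)

lemma UV_op_diff: "UV_op (x - y) f = (\<lambda>a. UV_op x f a - UV_op y f a)"
  using UV_op_add[of x "- y" f] by (simp add: UV_op_uminus)

lemma UV_op_sum: "UV_op (sum g A) f = (\<lambda>a. \<Sum>i\<in>A. UV_op (g i) f a)"
  by (induction A rule: infinite_finite_induct) (simp_all add: UV_op_0 UV_op_add)

section \<open>Action of the generators and their powers\<close>

lemma UV_op_gen_V: "UV_op gen_V f = (\<lambda>a. f (a - 1))"
  by (simp add: gen_V_def UV_op_single word_op_def)

lemma UV_op_gen_U:
  "UV_op gen_U f = (\<lambda>a. h * qnum q (a + (1 - int s)) * f (a + (1 - int s)))"
  by (simp add: gen_U_def UV_op_single word_op_def)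

lemma UV_op_gen_V_power: "UV_op (gen_V ^ e) f = (\<lambda>a. f (a - int e))"
  by (induction e) (simp_all add: UV_op_1 UV_op_mult UV_op_gen_V algebra_simps)

lemma UV_op_gen_U_power:
  "UV_op (gen_U ^ k) f =
    (\<lambda>a. h ^ k * (\<Prod>i<k. qnum q (a + int (Suc i) * (1 - int s))) * f (a + int k * (1 - int s)))"
proof (induction k)
  case (Suc k)
  have shift: "a + (1 - int s) + int n * (1 - int s) = a + int (Suc n) * (1 - int s)" for a n
    by (simp add: algebra_simps)
  show ?case
    unfolding power_Suc UV_op_mult Suc UV_op_gen_U shift prod.lessThan_Suc_shift
    by (simp add: mult_ac)
qed (simp add: UV_op_1)

context
  assumes q: "q \<noteq> 0"
begin

text \<open>All three terms are multiples of \<open>f (a - int s)\<close>; the coefficients cancel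
  because \<open>qnum q (x + 1) = 1 + q * qnum q x\<close>.\<close>

lemma UV_op_relation:
  "UV_op (gen_U * gen_V - scalar q * (gen_V * gen_U) - scalar h * gen_V ^ s) f = (\<lambda>a. 0)"
proof
  fix a
  have "qnum q (a + (1 - int s)) = 1 + q * qnum q (a - int s)"
    using qnum_add[OF q, of 1 "a - int s"] by (simp add: algebra_simps)
  then show "UV_op (gen_U * gen_V - scalar q * (gen_V * gen_U) - scalar h * gen_V ^ s) f a = 0"
    by (simp add: UV_op_diff UV_op_mult UV_op_scalar UV_op_gen_U UV_op_gen_V UV_op_gen_V_power)
      (simp add: algebra_simps)
qed

text \<open>The elements that annihilate every function form a two-sided ideal containing the
  generator, hence containing the ideal it generates.\<close>

lemma UV_op_ideal:
  assumes "x \<in> UV_ideal s h q"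
  shows "UV_op x f = (\<lambda>a. 0)"
proof -
  interpret ring free_UV_ring by (rule ring_free_UV_ring)
  let ?K = "{x. \<forall>f. UV_op x f = (\<lambda>a. 0)}"
  have zero: "UV_op x (\<lambda>a. 0) = (\<lambda>a. 0)" for x
    using UV_op_mult[of x 0] by (simp add: UV_op_0)
  have "ideal ?K free_UV_ring"
  proof (rule idealI[OF ring_free_UV_ring])
    show "subgroup ?K (add_monoid free_UV_ring)"
    proof (rule add.subgroupI)
      show "?K \<noteq> {}" using UV_op_0 by blast
      show "\<ominus>\<^bsub>free_UV_ring\<^esub> x \<in> ?K" if "x \<in> ?K" for x
        unfolding a_inv_free_UV_ring using that by (simp add: UV_op_uminus)
    qed (simp_all add: free_UV_ring_def UV_op_add)
  qed (simp_all add: free_UV_ring_def UV_op_mult zero)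
  then have "UV_ideal s h q \<subseteq> ?K"
    unfolding UV_ideal_def by (rule genideal_minimal) (simp add: UV_op_relation)
  then show ?thesis using assms by blast
qed

lemma UV_op_cong: "UV_cong s h q x y \<Longrightarrow> UV_op x f = UV_op y f"
  using UV_op_ideal[of "x - y" f] by (simp add: UV_cong_def UV_op_diff fun_eq_iff)

text \<open>The evaluation point is chosen so that the leftmost factor moves it to the point for the
  shorter lists: \<open>gen_V ^ r\<close> subtracts \<open>r\<close>, \<open>gen_U ^ t\<close> adds
  \<open>t\<close> times \<open>1 - s\<close>. The q-numbers met on the way form the last factor of
  \<open>Omega\<close>.\<close>

lemma UV_op_H_word:
  assumes "s \<noteq> 1" "length rs = length ss"
  shows "UV_op (H_word rs ss) (\<lambda>_. 1)
      ((int j - int (sum_list ss)) * (1 - int s) + int (sum_list rs)) =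
    h ^ sum_list ss * Omega s q rs ss j"
  using assms(2)
proof (induction rs ss rule: rev_induct2)
  case 1
  show ?case by (simp add: H_word_def UV_op_1 Omega_def)
next
  case (4 r rs t ss)
  let ?m = "1 - int s" and ?R = "sum_list rs" and ?S = "sum_list ss"
  let ?a = "(int j - int (?S + t)) * ?m + int ?R"
  have len: "length rs = length ss" using 4 by simp
  \<comment> \<open>Multiplying by \<open>1 - s\<close> clears the quotient in \<open>Omega\<close>,
    so \<open>floor\<close> acts on an integer.\<close>
  have floor: "\<lfloor>(real j - real ?S + real ?R / (1 - real s) - real i) * real_of_int ?m\<rfloor> =
      (int j - int ?S - int i) * ?m + int ?R" for i
  proof -
    have "1 - real s \<noteq> 0" using assms(1) by simp
    then have "(real j - real ?S + real ?R / (1 - real s) - real i) * real_of_int ?m =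
        real_of_int ((int j - int ?S - int i) * ?m + int ?R)"
      by (simp add: field_simps)
    then show ?thesis by (simp only: floor_of_int)
  qed
  have "qfalling q ?m (real j - real ?S + real ?R / (1 - real s)) t =
      (\<Prod>i<t. qnum q ((int j - int ?S - int i) * ?m + int ?R))"
    unfolding qfalling_def floor ..
  then have "Omega s q (rs @ [r]) (ss @ [t]) j =
      Omega s q rs ss j * (\<Prod>i<t. qnum q ((int j - int ?S - int i) * ?m + int ?R))"
    using len by (simp add: Omega_def nth_append)
  also have "(\<Prod>i<t. qnum q ((int j - int ?S - int i) * ?m + int ?R)) =
      (\<Prod>i<t. qnum q (?a + int (Suc i) * ?m))"
    \<comment> \<open>The two products list the same factors in opposite order.\<close>
    unfolding prod.nat_diff_reindex[symmetric, of "\<lambda>i. qnum q (?a + int (Suc i) * ?m)"]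
    by (intro prod.cong refl arg_cong[of _ _ "qnum q"]) (simp add: algebra_simps)
  finally have Omega: "Omega s q (rs @ [r]) (ss @ [t]) j =
      Omega s q rs ss j * (\<Prod>i<t. qnum q (?a + int (Suc i) * ?m))" .
  have arg: "?a + int t * ?m = (int j - int ?S) * ?m + int ?R"
    by (simp add: algebra_simps)
  have "UV_op (H_word (rs @ [r]) (ss @ [t])) (\<lambda>_. 1) (?a + int r) =
      h ^ t * (\<Prod>i<t. qnum q (?a + int (Suc i) * ?m)) * (h ^ ?S * Omega s q rs ss j)"
    unfolding H_word_snoc[OF len] UV_op_mult UV_op_gen_V_power UV_op_gen_U_power
      add_diff_cancel_right' arg 4(1)[OF len] ..
  then show ?case
    unfolding Omega by (simp add: power_add mult_ac add.assoc)
qed auto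

text \<open>The V-power moves the evaluation point to \<open>(j - k) * (1 - s)\<close>, where
  \<open>R\<close> and \<open>S\<close> have dropped out.\<close>

lemma UV_op_normal_monomial:
  assumes "0 \<le> int R - (int S - int k) * (1 - int s)"
  shows "UV_op (gen_V ^ nat (int R - (int S - int k) * (1 - int s)) * gen_U ^ k) (\<lambda>_. 1)
      ((int j - int S) * (1 - int s) + int R) =
    h ^ k * qfalling q (1 - int s) (real j) k"
proof -
  let ?m = "1 - int s"
  have arg: "(int j - int S) * ?m + int R - (int R - (int S - int k) * ?m) = (int j - int k) * ?m"
    by (simp add: algebra_simps)
  have "qfalling q ?m (real j) k = (\<Prod>i<k. qnum q ((int j - int k) * ?m + int (Suc i) * ?m))"
    unfolding qfalling_of_nat
      prod.nat_diff_reindex[symmetric, of "\<lambda>i. qnum q ((int j - int k) * ?m + int (Suc i) * ?m)"]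
    by (intro prod.cong refl arg_cong[of _ _ "qnum q"]) (simp add: algebra_simps)
  then show ?thesis
    using assms by (simp add: UV_op_mult UV_op_gen_V_power UV_op_gen_U_power arg)
qed

lemma normal_form_Omega:
  assumes "s \<noteq> 1" "length rs = length ss"
    and nf: "normal_form s h q (hd ss) (sum_list rs) (sum_list ss) (H_word rs ss) c"
  shows "h ^ sum_list ss * Omega s q rs ss j =
    (\<Sum>k\<le>j. c k * h ^ k * qfalling q (1 - int s) (real j) k)"
proof -
  let ?m = "1 - int s" and ?R = "sum_list rs" and ?S = "sum_list ss"
  let ?e = "\<lambda>k. int ?R - (int ?S - int k) * ?m"
  let ?a = "(int j - int ?S) * ?m + int ?R"
  let ?f = "\<lambda>k. c k * h ^ k * qfalling q ?m (real j) k"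
  have supp: "c k = 0" if "k < hd ss \<or> k > ?S \<or> ?e k < 0" for k
    using nf that unfolding normal_form_def by blast
  have cong: "UV_cong s h q (H_word rs ss)
      (\<Sum>k=hd ss..?S. scalar (c k) * (gen_V ^ nat (?e k) * gen_U ^ k))"
    using nf unfolding normal_form_def by (rule conjunct2)
  have "h ^ ?S * Omega s q rs ss j = UV_op (H_word rs ss) (\<lambda>_. 1) ?a"
    using UV_op_H_word[OF assms(1,2)] by simp
  also have "\<dots> = UV_op (\<Sum>k=hd ss..?S. scalar (c k) * (gen_V ^ nat (?e k) * gen_U ^ k)) (\<lambda>_. 1) ?a"
    by (simp only: UV_op_cong[OF cong])
  also have "\<dots> = sum ?f {hd ss..?S}"
    unfolding UV_op_sum
  proof (rule sum.cong[OF refl])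
    fix k
    show "UV_op (scalar (c k) * (gen_V ^ nat (?e k) * gen_U ^ k)) (\<lambda>_. 1) ?a = ?f k"
    proof (cases "?e k < 0")
      case True
      then show ?thesis using supp[of k] by (simp add: scalar_0 UV_op_0)
    next
      case False
      then show ?thesis
        unfolding UV_op_mult[of "scalar (c k)"] UV_op_scalar
        using UV_op_normal_monomial[of ?R ?S k j] by simp
    qed
  qed
  \<comment> \<open>A common superset of both ranges: the support of \<open>c\<close> allows the
    enlargement, the zeros of the falling factorial the cut to \<open>{..j}\<close>.\<close>
  also have "\<dots> = sum ?f {..j + ?S}"
    by (rule sum.mono_neutral_left) (auto simp: supp)
  also have "\<dots> = sum ?f {..j}"
    by (rule sum.mono_neutral_right) (auto simp: qfalling_of_nat_eq_0)
  finally show ?thesis .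
qed

end

end

section \<open>The explicit formula\<close>

theorem theorem12:
  fixes s n k :: nat and h q :: complex and rs ss :: "nat list"
  assumes "s \<noteq> 1"
    and "h \<noteq> 0"
    and "q \<noteq> 0"
    and "q = 1 \<or> \<not> (\<exists>m::nat. m > 0 \<and> q ^ m = 1)"
    and "n \<ge> 1"
    and "length rs = n"
    and "length ss = n"
  shows "S_coeff s h q rs ss k =
    h powi (int (sum_list ss) - int k) / qfactorial q (1 - int s) k *
    (\<Sum>j=0..k. (-1) ^ (k - j) * q powi (int ((k - j) choose 2) * (1 - int s)) *
       gaussian_binomial (q powi (1 - int s)) k j * Omega s q rs ss j)"
proof -
  let ?m = "1 - int s" and ?S = "sum_list ss"
  let ?p = "q powi ?m"
  \<comment> \<open>The claimed right-hand side as a function of the index, because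
    \<open>S_coeff\<close> describes a whole coefficient function.\<close>
  define F where "F k = h powi (int ?S - int k) / qfactorial q ?m k *
    (\<Sum>j=0..k. (-1) ^ (k - j) * q powi (int ((k - j) choose 2) * ?m) *
       gaussian_binomial ?p k j * Omega s q rs ss j)" for k
  have q: "one_or_no_root_of_unity q" using assms(3,4) unfolding one_or_no_root_of_unity_def by blast
  have p: "one_or_no_root_of_unity ?p" using one_or_no_root_of_unity_powi[OF q] assms(1) by simp
  have len: "length rs = length ss" "ss \<noteq> []" using assms by auto
  have fac: "qfactorial q ?m l \<noteq> 0" for l
    using qfactorial_eq[OF assms(3)] qfactorial_1_nonzero[OF p] qnum_nonzero[OF q] assms(1) by simp
  have falling: "qfalling q ?m (real j) l = gaussian_binomial ?p j l * qfactorial q ?m l"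
    if "l \<le> j" for j l
    using qfalling_of_nat_qfactorial[OF assms(3) that, of ?m] qfactorial_1_nonzero[OF p]
    unfolding gaussian_binomial_def qfactorial_eq[OF assms(3), of ?m l]
    by (simp add: field_simps)
  \<comment> \<open>The values of \<open>Omega\<close> determine \<open>c\<close> by inversion, so
    every normal ordering has the claimed coefficients.\<close>
  have unique: "c = F" if "is_normal_ordering s h q rs ss c" for c
  proof
    fix k
    have nf: "normal_form s h q (hd ss) (sum_list rs) ?S (H_word rs ss) c"
      using that is_normal_ordering_iff by simp
    have "(\<Sum>j\<le>k. (-1) ^ (k - j) * ?p ^ ((k - j) choose 2) * gaussian_binomial ?p k j *
        (h ^ ?S * Omega s q rs ss j)) = c k * h ^ k * qfactorial q ?m k"
    \<comment> \<open>The unknowns are \<open>c l * h ^ l * qfactorial q ?m l\<close>; by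
      \<open>falling\<close>, the expansion of \<open>Omega\<close> is their Gaussian binomial
      transform.\<close>
    proof (rule gaussian_binomial_inversion[OF p])
      fix j
      show "h ^ ?S * Omega s q rs ss j =
          (\<Sum>l\<le>j. gaussian_binomial ?p j l * (c l * h ^ l * qfactorial q ?m l))"
        unfolding normal_form_Omega[OF assms(3,1) len(1) nf]
        by (intro sum.cong refl) (simp add: falling mult_ac)
    qed
    also have "(\<Sum>j\<le>k. (-1) ^ (k - j) * ?p ^ ((k - j) choose 2) * gaussian_binomial ?p k j *
        (h ^ ?S * Omega s q rs ss j)) = h ^ ?S *
      (\<Sum>j=0..k. (-1) ^ (k - j) * q powi (int ((k - j) choose 2) * ?m) *
        gaussian_binomial ?p k j * Omega s q rs ss j)"
      by (simp add: sum_distrib_left atLeast0AtMost power_int_power' mult_ac)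
    finally show "c k = F k"
      using fac[of k] assms(2) by (simp add: F_def power_int_diff field_simps)
  qed
  obtain c where "is_normal_ordering s h q rs ss c"
    using normal_form_H_word[OF assms(3) len] is_normal_ordering_iff by blast
  \<comment> \<open>Existence and uniqueness together resolve the \<open>THE\<close>.\<close>
  then have "S_coeff s h q rs ss = F"
    unfolding S_coeff_def using unique by (metis the_equality)
  then show ?thesis by (simp add: F_def)
qed

end
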